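(* Let $\alpha_1,\alpha_2>0$ be constants. Let $H$ be a $\{1,2,3\}$-graph. Suppose both the order of a maximum complete $\{1,2,3\}$-subgraph of $H$ and the order of a maximum complete $\{1\}$-subgraph of $H$ equal $t$, where $$t\ge \left\lceil\frac{(\alpha_1+\alpha_2)^2-\alpha_2}{\alpha_1+\alpha_2}\right\rceil .$$ Then $$L_{\{\alpha_1,\alpha_2\}}(H)=L_{\{\alpha_1,\alpha_2\}}(K_t^{\{1,2,3\}})=1+\alpha_1\frac{t-1}{2t}+\alpha_2\frac{(t-1)(t-2)}{6t^2}.$$ Furthermore, the characteristic vector of a maximum clique of $H$ is a maximizer of $L_{\{\alpha_1,\alpha_2\}}(H,\vec x)$ over $S$.
   Context: A hypergraph $H=(V,E)$ with $V=[n]$ has edges that are subsets of $V$; $T(H)=\{|e|:e\in E\}$, and $H$ is a $T(H)$-graph. A $\{1,2,3\}$-graph has edges of sizes $1$, $2$ and $3$. $K_t^{\{1,2,3\}}$ is the hypergraph on $[t]$ whose edges are all subsets of $[t]$ of size $1$, $2$ or $3$. A complete $\{1,2,3\}$-subgraph of order $t$ is a set $W$ of $t$ vertices all of whose subsets of size $1,2,3$ are edges of $H$; a complete $\{1\}$-subgraph of order $t$ is a set of $t$ vertices each of whose singletons is an edge. A clique of $H$ is a complete subhypergraph with edge type set $T(H)$. Let $S=\{\vec x\in\mathbb{R}^n:\sum_i x_i=1,\ x_i\ge 0\}$. For $\vec x\in S$, $$L_{\{\alpha_1,\alpha_2\}}(H,\vec x)=\sum_{\{i\}\in E}x_i+\alpha_1\sum_{\{i,j\}\in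 E}x_ix_j+\alpha_2\sum_{\{i,j,k\}\in E}x_ix_jx_k,$$ and $L_{\{\alpha_1,\alpha_2\}}(H)=\max_{\vec x\in S}L_{\{\alpha_1,\alpha_2\}}(H,\vec x)$. The characteristic vector of $U\subseteq[n]$ has entries $1/|U|$ on $U$ and $0$ elsewhere. *)

theory Defs
  imports Complex_Main
begin

record hypergraph =
  nverts :: nat
  edges :: "nat set set"

definition verts :: "hypergraph \<Rightarrow> nat set" where
  "verts H = {1..nverts H}"

definition is_hypergraph :: "hypergraph \<Rightarrow> bool" where
  "is_hypergraph H \<longleftrightarrow> edges H \<subseteq> Pow (verts H)"

definition edge_types :: "hypergraph \<Rightarrow> nat set" where
  "edge_types H = card ` edges H"

definition is_typed_graph :: "nat set \<Rightarrow> hypergraph \<Rightarrow> bool" where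
  "is_typed_graph T H \<longleftrightarrow> is_hypergraph H \<and> edge_types H = T"

definition complete_graph :: "nat set \<Rightarrow> nat \<Rightarrow> hypergraph" where
  "complete_graph T t = \<lparr>nverts = t, edges = {e. e \<subseteq> {1..t} \<and> card e \<in> T}\<rparr>"

definition complete_subgraph :: "nat set \<Rightarrow> hypergraph \<Rightarrow> nat set \<Rightarrow> bool" where
  "complete_subgraph T H W \<longleftrightarrow> W \<subseteq> verts H \<and> (\<forall>e. e \<subseteq> W \<and> card e \<in> T \<longrightarrow> e \<in> edges H)"

definition max_complete_order :: "nat set \<Rightarrow> hypergraph \<Rightarrow> nat" where
  "max_complete_order T H = Max (card ` {W. complete_subgraph T H W})"

definition clique :: "hypergraph \<Rightarrow> nat set \<Rightarrow> bool" where
  "clique H W \<longleftrightarrow> complete_subgraph (edge_types H) H W"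

definition maximum_clique :: "hypergraph \<Rightarrow> nat set \<Rightarrow> bool" where
  "maximum_clique H = is_arg_max card (clique H)"

(* A vector of R^n is a function on nat that vanishes outside {1..n}. *)
definition simplex :: "nat \<Rightarrow> (nat \<Rightarrow> real) set" where
  "simplex n = {x. (\<forall>i. i \<notin> {1..n} \<longrightarrow> x i = 0) \<and> (\<forall>i\<in>{1..n}. 0 \<le> x i) \<and> (\<Sum>i=1..n. x i) = 1}"

definition edge_poly :: "nat \<Rightarrow> hypergraph \<Rightarrow> (nat \<Rightarrow> real) \<Rightarrow> real" where
  "edge_poly r H x = (\<Sum>e | e \<in> edges H \<and> card e = r. \<Prod>i\<in>e. x i)"

definition lagrange_poly :: "real \<Rightarrow> real \<Rightarrow> hypergraph \<Rightarrow> (nat \<Rightarrow> real) \<Rightarrow> real" where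
  "lagrange_poly \<alpha>1 \<alpha>2 H x = edge_poly 1 H x + \<alpha>1 * edge_poly 2 H x + \<alpha>2 * edge_poly 3 H x"

(* The maximum exists whenever nverts H > 0: the simplex is then compact and nonempty. *)
definition lagrangian :: "real \<Rightarrow> real \<Rightarrow> hypergraph \<Rightarrow> real" where
  "lagrangian \<alpha>1 \<alpha>2 H = (GREATEST v. v \<in> lagrange_poly \<alpha>1 \<alpha>2 H ` simplex (nverts H))"

definition char_vec :: "nat set \<Rightarrow> nat \<Rightarrow> real" where
  "char_vec U i = (if i \<in> U then 1 / real (card U) else 0)"

end

theory Submission
  imports Defs "HOL-Analysis.Convex"
begin

text \<open>Let \<open>S\<close> be the set of vertices that form singleton edges. Both orders being \<open>t\<close>
  forces \<open>S\<close> to be the unique maximum clique, with \<open>card S = t\<close>. Allowing every pair and every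
  triple as an edge only increases the polynomial, and by Newton's identities it then equals
  \<open>y + \<alpha>1 * (1 - p2) / 2 + \<alpha>2 * (1 - 3 * p2 + 2 * p3) / 6\<close>, where \<open>y\<close> is the weight of \<open>S\<close> and
  \<open>p2\<close>, \<open>p3\<close> are the power sums of \<open>x\<close>. A vertex outside \<open>S\<close> only lowers the last two terms,
  and on \<open>S\<close> they are largest when the weight is spread evenly. What remains is a
  cubic in \<open>y\<close>, and the lower bound on \<open>t\<close> is what makes its value at \<open>y = 1\<close> the largest.\<close>

section \<open>Elementary symmetric polynomials and Newton's identities\<close>

definition esym :: "nat \<Rightarrow> 'a set \<Rightarrow> ('a \<Rightarrow> real) \<Rightarrow> real" where
  "esym r A x = (\<Sum>e | e \<subseteq> A \<and> card e = r. \<Prod>i\<in>e. x i)"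

lemma esym_0: "finite A \<Longrightarrow> esym 0 A x = 1"
proof -
  assume "finite A"
  then have "{e. e \<subseteq> A \<and> card e = 0} = {{}}"
    by (auto dest: finite_subset)
  then show ?thesis by (simp add: esym_def)
qed

lemma esym_empty: "esym (Suc r) {} x = 0"
proof -
  have "{e::'a set. e \<subseteq> {} \<and> card e = Suc r} = {}" by auto
  then show ?thesis by (simp add: esym_def)
qed

text \<open>Splits the subsets of size \<open>Suc r\<close> by whether they contain
  \<open>a\<close>. This recursion drives the inductions behind Newton's identities.\<close>

lemma esym_insert:
  assumes "finite A" "a \<notin> A"
  shows "esym (Suc r) (insert a A) x = esym (Suc r) A x + x a * esym r A x"
proof -
  let ?N = "{e. e \<subseteq> A \<and> card e = Suc r}"
  let ?M = "{e. e \<subseteq> A \<and> card e = r}"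
  have fin: "finite e" if "e \<subseteq> A" for e using that assms(1) by (rule finite_subset)
  have split: "{e. e \<subseteq> insert a A \<and> card e = Suc r} = ?N \<union> insert a ` ?M"
  proof (intro equalityI subsetI)
    fix e assume e: "e \<in> {e. e \<subseteq> insert a A \<and> card e = Suc r}"
    show "e \<in> ?N \<union> insert a ` ?M"
    proof (cases "a \<in> e")
      case True
      have "e - {a} \<subseteq> A" "card (e - {a}) = r" using e True by auto
      then show ?thesis using True by (auto simp: image_iff intro!: exI[of _ "e - {a}"])
    qed (use e in auto)
  next
    fix e assume "e \<in> ?N \<union> insert a ` ?M"
    then show "e \<in> {e. e \<subseteq> insert a A \<and> card e = Suc r}"
    proof
      assume "e \<in> insert a ` ?M"
      then obtain f where f: "f \<subseteq> A" "card f = r" "e = insert a f" by auto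
      moreover have "a \<notin> f" using f(1) assms(2) by auto
      ultimately show ?thesis using fin[of f] by auto
    qed auto
  qed
  have inj: "inj_on (insert a) ?M"
    using assms(2) by (intro inj_onI) (metis (no_types, lifting) insert_ident mem_Collect_eq subset_iff)
  have "esym (Suc r) (insert a A) x
      = (\<Sum>e\<in>?N. \<Prod>i\<in>e. x i) + (\<Sum>e\<in>insert a ` ?M. \<Prod>i\<in>e. x i)"
    unfolding esym_def split using assms by (intro sum.union_disjoint) auto
  also have "(\<Sum>e\<in>insert a ` ?M. \<Prod>i\<in>e. x i) = (\<Sum>e\<in>?M. \<Prod>i\<in>insert a e. x i)"
    using inj by (simp add: sum.reindex)
  also have "\<dots> = (\<Sum>e\<in>?M. x a * (\<Prod>i\<in>e. x i))"
  proof (rule sum.cong)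
    fix e assume "e \<in> ?M"
    then show "(\<Prod>i\<in>insert a e. x i) = x a * (\<Prod>i\<in>e. x i)"
      using fin[of e] assms(2) by (intro prod.insert) auto
  qed simp
  finally show ?thesis by (simp add: esym_def sum_distrib_left)
qed

lemma esym_1: "finite A \<Longrightarrow> esym 1 A x = (\<Sum>i\<in>A. x i)"
proof (induction A rule: finite_induct)
  case empty
  then show ?case using esym_empty[of 0 x] by simp
next
  case (insert a A)
  then show ?case using esym_insert[of A a 0 x] by (simp add: esym_0)
qed

lemma esym_2:
  "finite A \<Longrightarrow> esym 2 A x = ((\<Sum>i\<in>A. x i)^2 - (\<Sum>i\<in>A. x i ^ 2)) / 2"
proof (induction A rule: finite_induct)
  case empty
  then show ?case using esym_empty[of 1 x] by (simp add: numeral_2_eq_2)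
next
  case (insert a A)
  have "esym 2 (insert a A) x = esym 2 A x + x a * (\<Sum>i\<in>A. x i)"
    using esym_insert[OF insert(1,2), of 1 x] esym_1[OF insert(1), of x]
    by (simp add: numeral_2_eq_2)
  then show ?case using insert by (simp add: field_simps power2_eq_square)
qed

lemma esym_3:
  "finite A \<Longrightarrow> esym 3 A x
    = ((\<Sum>i\<in>A. x i)^3 - 3 * (\<Sum>i\<in>A. x i) * (\<Sum>i\<in>A. x i ^ 2) + 2 * (\<Sum>i\<in>A. x i ^ 3)) / 6"
proof (induction A rule: finite_induct)
  case empty
  then show ?case using esym_empty[of 2 x] by (simp add: eval_nat_numeral)
next
  case (insert a A)
  have "esym 3 (insert a A) x = esym 3 A x + x a * esym 2 A x"
    using esym_insert[OF insert(1,2), of 2 x] by (simp add: eval_nat_numeral)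
  then show ?case using insert
    by (simp add: esym_2[OF insert(1)] field_simps power2_eq_square power3_eq_cube)
qed

section \<open>Power sums of nonnegative weights\<close>

text \<open>Chebyshev's sum argument for \<open>x i\<close> and \<open>x i * (s - x i)\<close>: the differences multiply to
  \<open>(x i - x j)^2 * (s - x i - x j)\<close>, which is nonnegative for \<open>i \<noteq> j\<close> because \<open>s\<close> is the
  full sum, so no monotonicity is needed.\<close>

lemma power_sum_3_le:
  fixes x :: "'a \<Rightarrow> real" and s :: real
  assumes fin: "finite A" and nn: "\<And>i. i \<in> A \<Longrightarrow> x i \<ge> 0"
  defines "s \<equiv> \<Sum>i\<in>A. x i"
  shows "real (card A) * (\<Sum>i\<in>A. x i ^ 3) \<le> (real (card A) + 1) * s * (\<Sum>i\<in>A. x i ^ 2) - s ^ 3"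
proof -
  let ?n = "real (card A)" and ?p = "\<Sum>i\<in>A. x i ^ 2" and ?q = "\<Sum>i\<in>A. x i ^ 3"
  have "0 \<le> (\<Sum>i\<in>A. \<Sum>j\<in>A. (x i - x j)^2 * (s - x i - x j))"
  proof (intro sum_nonneg)
    fix i j assume ij: "i \<in> A" "j \<in> A"
    show "0 \<le> (x i - x j)^2 * (s - x i - x j)"
    proof (cases "i = j")
      case False
      have "sum x {i, j} \<le> s"
        unfolding s_def using fin nn ij by (intro sum_mono2) auto
      then show ?thesis using False by simp
    qed simp
  qed
  also have "\<dots> = (\<Sum>i\<in>A. \<Sum>j\<in>A. s * x i ^ 2 - x i ^ 3 + x i ^ 2 * x j - 2 * s * (x i * x j)
      + x i * x j ^ 2 + s * x j ^ 2 - x j ^ 3)"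
    by (intro sum.cong refl) (simp add: algebra_simps power2_eq_square power3_eq_cube)
  also have "\<dots> = (\<Sum>i\<in>A. ?n * (s * x i ^ 2) - ?n * x i ^ 3 + x i ^ 2 * s - 2 * s * (x i * s)
      + x i * ?p + s * ?p - ?q)"
  proof (rule sum.cong)
    fix i assume "i \<in> A"
    have "(\<Sum>j\<in>A. x i ^ 2 * x j) = x i ^ 2 * s" "(\<Sum>j\<in>A. 2 * s * (x i * x j)) = 2 * s * (x i * s)"
      "(\<Sum>j\<in>A. x i * x j ^ 2) = x i * ?p" "(\<Sum>j\<in>A. s * x j ^ 2) = s * ?p"
      by (simp_all only: sum_distrib_left[symmetric] s_def[symmetric])
    then show "(\<Sum>j\<in>A. s * x i ^ 2 - x i ^ 3 + x i ^ 2 * x j - 2 * s * (x i * x j)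
        + x i * x j ^ 2 + s * x j ^ 2 - x j ^ 3)
      = ?n * (s * x i ^ 2) - ?n * x i ^ 3 + x i ^ 2 * s - 2 * s * (x i * s) + x i * ?p + s * ?p - ?q"
      by (simp only: sum.distrib sum_subtractf sum_constant)
  qed simp
  also have "\<dots> = ?n * (s * ?p) - ?n * ?q + ?p * s - 2 * s * (s * s) + s * ?p + ?n * (s * ?p) - ?n * ?q"
  proof -
    have "(\<Sum>i\<in>A. ?n * (s * x i ^ 2)) = ?n * (s * ?p)" "(\<Sum>i\<in>A. ?n * x i ^ 3) = ?n * ?q"
      "(\<Sum>i\<in>A. x i ^ 2 * s) = ?p * s" "(\<Sum>i\<in>A. x i * ?p) = s * ?p"
      by (simp_all only: sum_distrib_left[symmetric] sum_distrib_right[symmetric] s_def[symmetric])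
    moreover have "(\<Sum>i\<in>A. 2 * s * (x i * s)) = 2 * s * (s * s)"
      by (simp only: sum_distrib_left[symmetric] sum_distrib_right[symmetric] s_def[symmetric])
    ultimately show ?thesis by (simp only: sum.distrib sum_subtractf sum_constant)
  qed
  \<comment> \<open>The double sum is symmetric in \<open>i\<close> and \<open>j\<close>, so it is
    twice the difference of the two sides of the claim.\<close>
  finally show ?thesis by (simp add: algebra_simps power3_eq_cube)
qed

text \<open>\<open>power_sum_3_le\<close> trades the cubic power sum for the quadratic one, which is
  left with a nonpositive coefficient. The Cauchy-Schwarz lower bound \<open>y^2 / t\<close> on it
  then gives the claim, with equality at equal weights.\<close>

lemma power_sums_le_balanced:
  fixes x :: "'a \<Rightarrow> real"
  assumes fin: "finite A" and ne: "A \<noteq> {}" and nn: "\<And>i. i \<in> A \<Longrightarrow> x i \<ge> 0"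
  defines "y \<equiv> \<Sum>i\<in>A. x i" and "t \<equiv> real (card A)"
  assumes y1: "y \<le> 1"
  shows "2 * (\<Sum>i\<in>A. x i ^ 3) - 3 * (\<Sum>i\<in>A. x i ^ 2) \<le> 2 * y^3 / t^2 - 3 * y^2 / t"
\<comment> \<open>A single vertex is set apart: the coefficient
  \<open>3 * t - 2 * (t + 1) * y\<close> used below is \<open>3 - 4 * y\<close> for
  \<open>t = 1\<close> and may be negative, while for \<open>t \<ge> 2\<close> and
  \<open>y \<le> 1\<close> it is at least \<open>t - 2\<close>.\<close>
proof (cases "card A = 1")
  case True
  then obtain a where "A = {a}" by (auto simp: card_1_singleton_iff)
  then show ?thesis by (simp add: y_def t_def)
next
  case False
  let ?p = "\<Sum>i\<in>A. x i ^ 2" and ?q = "\<Sum>i\<in>A. x i ^ 3"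
  have "card A \<noteq> 0" using fin ne by simp
  then have t: "t \<ge> 2" using False by (simp add: t_def)
  have q: "t * ?q \<le> (t + 1) * y * ?p - y^3"
    using power_sum_3_le[OF fin nn] by (simp add: y_def t_def add.commute)
  have p: "y^2 / t \<le> ?p"
    using sum_squared_le_sum_of_squares[of x A] t
    by (simp add: y_def t_def field_simps)
  have "0 \<le> y" using nn by (simp add: y_def sum_nonneg)
  have "2 * (t + 1) * y \<le> 2 * (t + 1) * 1" using y1 t by (intro mult_left_mono) auto
  then have c: "0 \<le> 3 * t - 2 * (t + 1) * y" using t by (simp add: algebra_simps)
  have "t * (2 * ?q - 3 * ?p) \<le> - (3 * t - 2 * (t + 1) * y) * ?p - 2 * y^3"
    using q by (simp add: algebra_simps)
  also have "\<dots> \<le> - (3 * t - 2 * (t + 1) * y) * (y^2 / t) - 2 * y^3"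
    using mult_left_mono[OF p c] by (simp only: mult_minus_left)
  also have "\<dots> = t * (2 * y^3 / t^2 - 3 * y^2 / t)"
    using t by (simp add: field_simps power2_eq_square power3_eq_cube)
  finally show ?thesis using t by simp
qed

section \<open>The upper bound with all pairs and triples allowed\<close>

lemma quadratic_nonneg_of_order_bound:
  fixes a b t u :: real
  assumes "a > 0" "b > 0" "t > 0" "t \<ge> (a^2 - b) / a" "u > 0" "u * t \<le> 1"
  shows "1 - a * u + b * u^2 \<ge> 0"
proof -
  define s where "s = 1 / u"
  have st: "s \<ge> t" using assms by (simp add: s_def field_simps)
  then have s: "s > 0" "a * (a - s) \<le> b"
    using assms(3) order_trans[OF assms(4) st] assms(1)
    by (auto simp: field_simps power2_eq_square)
  \<comment> \<open>In terms of \<open>s = 1 / u\<close> the goal reads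
    \<open>s^2 - a * s + b \<ge> 0\<close>. The bound on \<open>t\<close> yields
    \<open>a * (a - s) \<le> b\<close>; the product \<open>s * (a - s)\<close> is at most
    \<open>a * (a - s)\<close> if \<open>s \<le> a\<close>, and nonpositive otherwise.\<close>
  have "s * (a - s) \<le> b"
  proof (cases "a \<ge> s")
    case True
    then have "s * (a - s) \<le> a * (a - s)" by (intro mult_right_mono) auto
    then show ?thesis using s by simp
  next
    case False
    then have "s * (a - s) \<le> 0" using s(1) by (intro mult_nonneg_nonpos) auto
    then show ?thesis using assms(2) by simp
  qed
  then have "0 \<le> u^2 * (b - s * (a - s))" by simp
  also have "\<dots> = 1 - a * u + b * u^2"
    using assms(5) by (simp add: s_def field_simps power2_eq_square)
  finally show ?thesis .
qed

text \<open>\<open>A\<close> stands for the vertices with singleton edges. Once the power sums are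
  bounded, a cubic in the weight \<open>y\<close> of \<open>A\<close> remains; its value at 1 minus
  its value at \<open>y\<close> is \<open>1 - y\<close> times a factor that the bound on
  \<open>t\<close> keeps nonnegative.\<close>

lemma esym_bound:
  fixes x :: "'a \<Rightarrow> real" and \<alpha>1 \<alpha>2 :: real
  assumes fin: "finite V" and AV: "A \<subseteq> V" and ne: "A \<noteq> {}"
    and nn: "\<And>i. i \<in> V \<Longrightarrow> x i \<ge> 0" and sum1: "(\<Sum>i\<in>V. x i) = 1"
    and \<alpha>: "\<alpha>1 > 0" "\<alpha>2 > 0"
  defines "t \<equiv> real (card A)"
  assumes bound: "t \<ge> ((\<alpha>1 + \<alpha>2)^2 - \<alpha>2) / (\<alpha>1 + \<alpha>2)"
  shows "(\<Sum>i\<in>A. x i) + \<alpha>1 * esym 2 V x + \<alpha>2 * esym 3 V x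
    \<le> 1 + \<alpha>1 * ((t - 1) / (2 * t)) + \<alpha>2 * ((t - 1) * (t - 2) / (6 * t^2))"
proof -
  define y where "y = (\<Sum>i\<in>A. x i)"
  have finA: "finite A" using fin AV by (rule rev_finite_subset)
  have t: "t > 0" using finA ne by (simp add: t_def card_gt_0_iff)
  have nnA: "\<And>i. i \<in> A \<Longrightarrow> x i \<ge> 0" using nn AV by auto
  have y: "0 \<le> y" "y \<le> 1"
    using sum_mono2[OF fin AV, of x] nn nnA sum1 by (auto simp: y_def intro: sum_nonneg)
  have le1: "x i \<le> 1" if "i \<in> V" for i
    using member_le_sum[of i V x] that fin nn sum1 by auto
  let ?p = "\<lambda>B. \<Sum>i\<in>B. x i ^ 2" and ?q = "\<lambda>B. \<Sum>i\<in>B. x i ^ 3"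
  have pV: "y^2 / t \<le> ?p V"
  proof -
    have "y^2 / t \<le> ?p A"
      using sum_squared_le_sum_of_squares[of x A] t
      by (simp add: y_def t_def field_simps)
    also have "\<dots> \<le> ?p V" using fin AV by (intro sum_mono2) auto
    finally show ?thesis .
  qed
  \<comment> \<open>The cubic power sum enters with a positive sign although equal weights minimize
    it, so it is bounded only jointly with the quadratic one.\<close>
  have "2 * ?q V - 3 * ?p V = (\<Sum>i\<in>V. 2 * x i ^ 3 - 3 * x i ^ 2)"
    by (simp add: sum_subtractf sum_distrib_left)
  also have "\<dots> = (\<Sum>i\<in>V - A. 2 * x i ^ 3 - 3 * x i ^ 2) + (\<Sum>i\<in>A. 2 * x i ^ 3 - 3 * x i ^ 2)"
    by (rule sum.subset_diff[OF AV fin])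
  also have "(\<Sum>i\<in>V - A. 2 * x i ^ 3 - 3 * x i ^ 2) \<le> 0"
  proof (rule sum_nonpos)
    fix i assume "i \<in> V - A"
    then have "x i ^ 2 * (2 * x i - 3) \<le> 0"
      using le1[of i] by (intro mult_nonneg_nonpos) auto
    then show "2 * x i ^ 3 - 3 * x i ^ 2 \<le> 0"
      by (simp add: algebra_simps power2_eq_square power3_eq_cube)
  qed
  also have "(\<Sum>i\<in>A. 2 * x i ^ 3 - 3 * x i ^ 2) = 2 * ?q A - 3 * ?p A"
    by (simp add: sum_subtractf sum_distrib_left)
  also have "\<dots> \<le> 2 * y^3 / t^2 - 3 * y^2 / t"
    using power_sums_le_balanced[OF finA ne nnA] y by (simp add: y_def t_def)
  finally have qV: "2 * ?q V - 3 * ?p V \<le> 2 * y^3 / t^2 - 3 * y^2 / t" by simp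
  let ?a = "\<alpha>1 + \<alpha>2"
  \<comment> \<open>\<open>?u\<close> is read off the term linear in \<open>1 / t\<close> of the
    factor of \<open>1 - y\<close>. Replacing \<open>(1 + y + y^2) / (3 * t^2)\<close> by
    \<open>?u^2\<close> only lowers that factor, and \<open>?u * t = (1 + y) / 2 \<le> 1\<close>
    makes the quadratic estimate applicable.\<close>
  let ?u = "(1 + y) / (2 * t)"
  have "0 \<le> 1 - ?a * ?u + \<alpha>2 * ?u^2"
    using \<alpha> bound t y by (intro quadratic_nonneg_of_order_bound[of _ _ t]) (auto simp: field_simps)
  also have "\<dots> \<le> 1 - ?a * ?u + \<alpha>2 * ((1 + y + y^2) / (3 * t^2))"
  proof -
    have "(1 + y + y^2) / (3 * t^2) - ?u^2 = (1 - y)^2 / (12 * t^2)"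
      using t by (simp add: field_simps power2_eq_square)
    also have "\<dots> \<ge> 0" by simp
    finally have "?u^2 \<le> (1 + y + y^2) / (3 * t^2)" by simp
    then have "\<alpha>2 * ?u^2 \<le> \<alpha>2 * ((1 + y + y^2) / (3 * t^2))"
      using \<alpha>(2) by (intro mult_left_mono) auto
    then show ?thesis by linarith
  qed
  finally have br: "0 \<le> 1 - ?a * ?u + \<alpha>2 * ((1 + y + y^2) / (3 * t^2))" .
  have "y + \<alpha>1 * esym 2 V x + \<alpha>2 * esym 3 V x
      = y + \<alpha>1 * ((1 - ?p V) / 2) + \<alpha>2 * ((1 + (2 * ?q V - 3 * ?p V)) / 6)"
    using fin by (simp add: esym_2 esym_3 sum1)
  also have "\<dots> \<le> y + \<alpha>1 * ((1 - y^2 / t) / 2) + \<alpha>2 * ((1 + (2 * y^3 / t^2 - 3 * y^2 / t)) / 6)"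
    using pV qV \<alpha> by (intro add_mono mult_left_mono divide_right_mono diff_left_mono) auto
  also have "\<dots> = 1 + \<alpha>1 * ((t - 1) / (2 * t)) + \<alpha>2 * ((t - 1) * (t - 2) / (6 * t^2))
      - (1 - y) * (1 - ?a * ?u + \<alpha>2 * ((1 + y + y^2) / (3 * t^2)))"
    using t by (simp add: field_simps power2_eq_square power3_eq_cube)
  also have "\<dots> \<le> 1 + \<alpha>1 * ((t - 1) / (2 * t)) + \<alpha>2 * ((t - 1) * (t - 2) / (6 * t^2))"
    using br y by simp
  finally show ?thesis by (simp add: y_def)
qed

section \<open>Singleton edges and comparison of \<open>edge_poly\<close> with
  \<open>esym\<close>\<close>

definition loops :: "hypergraph \<Rightarrow> nat set" where
  "loops H = {i. {i} \<in> edges H}"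

lemma loops_subset_verts: "is_hypergraph H \<Longrightarrow> loops H \<subseteq> verts H"
  by (auto simp: loops_def is_hypergraph_def)

lemma finite_verts: "finite (verts H)"
  by (simp add: verts_def)

lemma edge_poly_1: "edge_poly 1 H x = (\<Sum>i\<in>loops H. x i)"
proof -
  have "{e. e \<in> edges H \<and> card e = 1} = (\<lambda>i. {i}) ` loops H"
    by (auto simp: loops_def card_1_singleton_iff)
  then show ?thesis by (simp add: edge_poly_def sum.reindex)
qed

lemma edge_poly_le_esym:
  assumes "is_hypergraph H" "\<And>i. i \<in> verts H \<Longrightarrow> x i \<ge> 0"
  shows "edge_poly r H x \<le> esym r (verts H) x"
  unfolding edge_poly_def esym_def
  using assms by (intro sum_mono2 prod_nonneg) (auto simp: is_hypergraph_def finite_verts)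

text \<open>Only degrees 2 and 3 are enlarged. The degree 1 part stays the weight of
  \<open>loops H\<close>, since it is what penalizes weight placed elsewhere.\<close>

lemma lagrange_poly_le:
  assumes "is_hypergraph H" "x \<in> simplex (nverts H)" "loops H \<noteq> {}" "card (loops H) = t"
    and \<alpha>: "\<alpha>1 > 0" "\<alpha>2 > 0" and "real t \<ge> ((\<alpha>1 + \<alpha>2)^2 - \<alpha>2) / (\<alpha>1 + \<alpha>2)"
  shows "lagrange_poly \<alpha>1 \<alpha>2 H x \<le> 1 + \<alpha>1 * ((real t - 1) / (2 * real t))
            + \<alpha>2 * ((real t - 1) * (real t - 2) / (6 * (real t)^2))"
proof -
  have nn: "\<And>i. i \<in> verts H \<Longrightarrow> x i \<ge> 0" and sum1: "(\<Sum>i\<in>verts H. x i) = 1"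
    using assms(2) by (auto simp: simplex_def verts_def)
  have "lagrange_poly \<alpha>1 \<alpha>2 H x
      \<le> (\<Sum>i\<in>loops H. x i) + \<alpha>1 * esym 2 (verts H) x + \<alpha>2 * esym 3 (verts H) x"
    unfolding lagrange_poly_def edge_poly_1
    using \<alpha> edge_poly_le_esym[OF assms(1) nn] by (intro add_mono mult_left_mono) auto
  also have "\<dots> \<le> 1 + \<alpha>1 * ((real t - 1) / (2 * real t))
            + \<alpha>2 * ((real t - 1) * (real t - 2) / (6 * (real t)^2))"
    using esym_bound[OF finite_verts loops_subset_verts[OF assms(1)] assms(3) nn sum1 \<alpha>] assms(4,7)
    by simp
  finally show ?thesis .
qed

section \<open>The value at a characteristic vector\<close>

lemma edge_poly_char_vec:
  assumes "is_hypergraph H" "complete_subgraph T H U" "r \<in> T"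
  shows "edge_poly r H (char_vec U) = esym r U (char_vec U)"
  unfolding edge_poly_def esym_def
proof (rule sum.mono_neutral_right)
  have "edges H \<subseteq> Pow (verts H)" using assms(1) by (simp add: is_hypergraph_def)
  then have fin: "finite (edges H)" and fine: "\<And>e. e \<in> edges H \<Longrightarrow> finite e"
    using finite_verts[of H] by (auto intro: finite_subset)
  show "finite {e. e \<in> edges H \<and> card e = r}" using fin by simp
  show "{e. e \<subseteq> U \<and> card e = r} \<subseteq> {e. e \<in> edges H \<and> card e = r}"
    using assms(2,3) by (auto simp: complete_subgraph_def)
  \<comment> \<open>An edge not inside \<open>U\<close> has a vertex of weight 0. Its product
    vanishes because the edge is finite; a product over an infinite set would be 1.\<close>
  show "\<forall>e\<in>{e. e \<in> edges H \<and> card e = r} - {e. e \<subseteq> U \<and> card e = r}. prod (char_vec U) e = 0"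
    using fine by (auto simp: char_vec_def subset_iff)
qed

lemma sum_char_vec_power:
  assumes "finite U"
  shows "(\<Sum>i\<in>U. char_vec U i ^ k) = card U * (1 / real (card U)) ^ k"
  by (simp add: char_vec_def)

text \<open>The power sums of \<open>char_vec U\<close> over \<open>U\<close> are 1,
  \<open>1 / t\<close> and \<open>1 / t^2\<close>, and Newton's identities turn them into the closed
  form.\<close>

lemma lagrange_poly_char_vec:
  assumes "is_hypergraph H" "complete_subgraph {1, 2, 3} H U" "U \<noteq> {}" "card U = t"
  shows "lagrange_poly \<alpha>1 \<alpha>2 H (char_vec U) = 1 + \<alpha>1 * ((real t - 1) / (2 * real t))
            + \<alpha>2 * ((real t - 1) * (real t - 2) / (6 * (real t)^2))"
proof -
  have fin: "finite U"
    using assms(2) finite_verts by (auto simp: complete_subgraph_def intro: finite_subset)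
  then have t: "real t > 0" using assms(3,4) by (auto simp: card_gt_0_iff)
  have 1: "(\<Sum>i\<in>U. char_vec U i) = 1"
    using sum_char_vec_power[OF fin, of 1] t assms(4) by simp
  have "edge_poly r H (char_vec U) = esym r U (char_vec U)" if "r \<in> {1, 2, 3}" for r
    using edge_poly_char_vec[OF assms(1,2) that] .
  then have "lagrange_poly \<alpha>1 \<alpha>2 H (char_vec U)
      = esym 1 U (char_vec U) + \<alpha>1 * esym 2 U (char_vec U) + \<alpha>2 * esym 3 U (char_vec U)"
    by (simp add: lagrange_poly_def)
  also have "\<dots> = 1 + \<alpha>1 * ((1 - t * (1 / t)^2) / 2) + \<alpha>2 * ((1 - 3 * (t * (1 / t)^2) + 2 * (t * (1 / t)^3)) / 6)"
    using fin assms(4) by (simp only: esym_1 esym_2 esym_3 1 sum_char_vec_power) simp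
  also have "(1 - t * (1 / t)^2) / 2 = (real t - 1) / (2 * real t)"
    using t by (simp add: field_simps power2_eq_square)
  also have "(1 - 3 * (t * (1 / t)^2) + 2 * (t * (1 / t)^3)) / 6
      = (real t - 1) * (real t - 2) / (6 * (real t)^2)"
    using t by (simp add: field_simps power2_eq_square power3_eq_cube)
  finally show ?thesis .
qed

lemma char_vec_in_simplex:
  assumes "U \<subseteq> {1..n}" "U \<noteq> {}"
  shows "char_vec U \<in> simplex n"
proof -
  have fin: "finite U" using assms(1) by (rule finite_subset) simp
  have "(\<Sum>i=1..n. char_vec U i) = (\<Sum>i\<in>U. char_vec U i)"
    using assms(1) by (intro sum.mono_neutral_right) (auto simp: char_vec_def)
  also have "\<dots> = 1" using sum_char_vec_power[OF fin, of 1] fin assms(2) by simp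
  finally show ?thesis using assms(1) by (auto simp: simplex_def char_vec_def)
qed

text \<open>Serves both \<open>H\<close> and the complete graph. The latter lacks some edge sizes
  when \<open>t < 3\<close>, hence the assumption of completeness instead of one on
  \<open>edge_types\<close>. The upper bound is attained, so \<open>GREATEST\<close> denotes
  it.\<close>

lemma is_arg_max_char_vec_and_lagrangian:
  assumes H: "is_hypergraph H" and U: "complete_subgraph {1, 2, 3} H U" "U = loops H"
    and ne: "U \<noteq> {}" and t: "card U = t"
    and \<alpha>: "\<alpha>1 > 0" "\<alpha>2 > 0" and bound: "real t \<ge> ((\<alpha>1 + \<alpha>2)^2 - \<alpha>2) / (\<alpha>1 + \<alpha>2)"
  shows "is_arg_max (lagrange_poly \<alpha>1 \<alpha>2 H) (\<lambda>x. x \<in> simplex (nverts H)) (char_vec U)"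
    and "lagrangian \<alpha>1 \<alpha>2 H = 1 + \<alpha>1 * ((real t - 1) / (2 * real t))
            + \<alpha>2 * ((real t - 1) * (real t - 2) / (6 * (real t)^2))" (is "_ = ?v")
proof -
  have le: "lagrange_poly \<alpha>1 \<alpha>2 H x \<le> ?v" if "x \<in> simplex (nverts H)" for x
    using lagrange_poly_le[OF H that _ _ \<alpha> bound] U(2) ne t by simp
  have val: "lagrange_poly \<alpha>1 \<alpha>2 H (char_vec U) = ?v"
    by (rule lagrange_poly_char_vec[OF H U(1) ne t])
  have mem: "char_vec U \<in> simplex (nverts H)"
    using U(1) ne by (intro char_vec_in_simplex) (auto simp: complete_subgraph_def verts_def)
  show "is_arg_max (lagrange_poly \<alpha>1 \<alpha>2 H) (\<lambda>x. x \<in> simplex (nverts H)) (char_vec U)"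
    using le val mem by (auto simp: is_arg_max_linorder)
  show "lagrangian \<alpha>1 \<alpha>2 H = ?v"
    unfolding lagrangian_def
    using le val mem by (intro Greatest_equality) (auto simp: image_iff intro!: bexI[of _ "char_vec U"])
qed

section \<open>Orders of maximum complete subgraphs\<close>

lemma finite_complete_subgraphs: "finite {W. complete_subgraph T H W}"
  by (rule finite_subset[of _ "Pow (verts H)"]) (auto simp: complete_subgraph_def finite_verts)

lemma card_le_max_complete_order:
  "complete_subgraph T H W \<Longrightarrow> card W \<le> max_complete_order T H"
  unfolding max_complete_order_def using finite_complete_subgraphs by (intro Max_ge) auto

text \<open>With 0 outside \<open>T\<close> the empty set is vacuously complete, so
  \<open>Max\<close> ranges over a nonempty finite set.\<close>

lemma max_complete_order_attained:
  assumes "0 \<notin> T"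
  obtains W where "complete_subgraph T H W" "card W = max_complete_order T H"
proof -
  have "complete_subgraph T H {}" using assms by (auto simp: complete_subgraph_def)
  then have "max_complete_order T H \<in> card ` {W. complete_subgraph T H W}"
    unfolding max_complete_order_def using finite_complete_subgraphs by (intro Max_in) auto
  then show ?thesis using that by auto
qed

lemma complete_subgraph_subset_loops:
  "complete_subgraph T H W \<Longrightarrow> 1 \<in> T \<Longrightarrow> W \<subseteq> loops H"
  by (auto simp: complete_subgraph_def loops_def)

text \<open>The sets complete for type 1 are exactly the subsets of \<open>loops H\<close>.\<close>

lemma max_complete_order_1:
  assumes "is_hypergraph H"
  shows "max_complete_order {1} H = card (loops H)"
proof (rule antisym)
  have fin: "finite (loops H)"
    using loops_subset_verts[OF assms] finite_verts by (rule finite_subset)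
  obtain W where W: "complete_subgraph {1} H W" "card W = max_complete_order {1} H"
    by (rule max_complete_order_attained[of "{1}" H]) auto
  then show "max_complete_order {1} H \<le> card (loops H)"
    using card_mono[OF fin complete_subgraph_subset_loops[OF W(1)]] by simp
  have "complete_subgraph {1} H (loops H)"
    using loops_subset_verts[OF assms]
    by (auto simp: complete_subgraph_def loops_def card_1_singleton_iff)
  then show "card (loops H) \<le> max_complete_order {1} H" by (rule card_le_max_complete_order)
qed

text \<open>Turns equality of the two orders into structure: such a set lies inside the finite set
  \<open>loops H\<close>, and equal cardinality leaves no room.\<close>

lemma maximum_complete_subgraph_eq_loops:
  assumes "is_hypergraph H" "complete_subgraph T H W" "1 \<in> T" "card W = card (loops H)"
  shows "W = loops H"
  using assms finite_subset[OF loops_subset_verts finite_verts, of H]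
  by (intro card_subset_eq complete_subgraph_subset_loops) auto

theorem theorem8:
  fixes \<alpha>1 \<alpha>2 :: real and H :: hypergraph and t :: nat
  assumes "\<alpha>1 > 0" and "\<alpha>2 > 0"
    and "is_typed_graph {1, 2, 3} H"
    and "max_complete_order {1, 2, 3} H = t"
    and "max_complete_order {1} H = t"
    and "int t \<ge> \<lceil>((\<alpha>1 + \<alpha>2)^2 - \<alpha>2) / (\<alpha>1 + \<alpha>2)\<rceil>"
  shows "lagrangian \<alpha>1 \<alpha>2 H = lagrangian \<alpha>1 \<alpha>2 (complete_graph {1, 2, 3} t)
    \<and> lagrangian \<alpha>1 \<alpha>2 (complete_graph {1, 2, 3} t)
        = 1 + \<alpha>1 * ((real t - 1) / (2 * real t))
            + \<alpha>2 * ((real t - 1) * (real t - 2) / (6 * (real t)^2))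
    \<and> (\<forall>U. maximum_clique H U \<longrightarrow>
          is_arg_max (lagrange_poly \<alpha>1 \<alpha>2 H) (\<lambda>x. x \<in> simplex (nverts H)) (char_vec U))"
proof -
  have H: "is_hypergraph H" and T: "edge_types H = {1, 2, 3}"
    using assms(3) by (auto simp: is_typed_graph_def)
  have bound: "real t \<ge> ((\<alpha>1 + \<alpha>2)^2 - \<alpha>2) / (\<alpha>1 + \<alpha>2)"
    using assms(6) by (simp add: ceiling_le_iff)
  have card: "card (loops H) = t" using max_complete_order_1[OF H] assms(5) by simp
  \<comment> \<open>The edge type 1 must occur, which makes \<open>t\<close> positive and keeps the
    closed form free of division by zero.\<close>
  have "1 \<in> card ` edges H" using T by (simp add: edge_types_def)
  then obtain e where "e \<in> edges H" "card e = 1" by (metis imageE)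
  then have ne: "loops H \<noteq> {}" by (metis card_1_singletonE empty_iff loops_def mem_Collect_eq)
  obtain W where W: "complete_subgraph {1, 2, 3} H W" "card W = t"
    using max_complete_order_attained[of "{1, 2, 3}" H] assms(4) by auto
  then have "W = loops H"
    using maximum_complete_subgraph_eq_loops[OF H W(1)] card by simp
  with W have loops: "complete_subgraph {1, 2, 3} H (loops H)" by simp
  note main = is_arg_max_char_vec_and_lagrangian[OF H loops refl ne card assms(1,2) bound]

  let ?K = "complete_graph {1, 2, 3} t"
  have "is_hypergraph ?K" "complete_subgraph {1, 2, 3} ?K {1..t}" and "{1..t} = loops ?K"
    by (auto simp: is_hypergraph_def complete_graph_def complete_subgraph_def verts_def loops_def)
  moreover have "{1..t} \<noteq> {}"
  proof -
    have "finite (loops H)" using loops_subset_verts[OF H] finite_verts by (rule finite_subset)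
    then have "0 < t" using ne card by (auto simp: card_gt_0_iff)
    then show ?thesis by simp
  qed
  ultimately have K: "lagrangian \<alpha>1 \<alpha>2 ?K = 1 + \<alpha>1 * ((real t - 1) / (2 * real t))
            + \<alpha>2 * ((real t - 1) * (real t - 2) / (6 * (real t)^2))"
    by (rule is_arg_max_char_vec_and_lagrangian(2)[OF _ _ _ _ _ assms(1,2) bound]) simp

  \<comment> \<open>\<open>loops H\<close> is itself a clique, so a maximum clique has at least
    \<open>t\<close> vertices; as a complete subgraph it has at most \<open>t\<close>.\<close>
  have "U = loops H" if "maximum_clique H U" for U
  proof -
    have U: "complete_subgraph {1, 2, 3} H U" and "card (loops H) \<le> card U"
      using that loops by (auto simp: maximum_clique_def clique_def T is_arg_max_linorder)
    moreover have "card U \<le> t" using card_le_max_complete_order[OF U] assms(4) by simp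
    ultimately show ?thesis
      using maximum_complete_subgraph_eq_loops[OF H U] card by simp
  qed
  then show ?thesis using main K by auto
qed

end
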